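(* Let $j>0$ and $A>0$, and set $R_\delta=1-A\delta$. For every $\delta>0$ small enough there is a unique function $\rho_\delta:[0,1]\to[0,\infty)$, continuous on $[0,R_\delta]$ and vanishing on $(R_\delta,1]$, such that $u=j\delta D_0+\rho_\delta$ satisfies $S^{(\delta,-)}_\delta(u)=u$ with cut point $R^{(\delta)}_{G^{\rm neum}_\delta*u}=R_\delta$. Moreover, for every $r\in[0,1)$, $$\lim_{\delta\to0}\rho_\delta(r)=2j(1-r)+\frac jA.$$
   Context: $D_0$ is the Dirac delta at $0$. $G^{\rm neum}_t(r,r')$ is the Green function of $\partial_t\rho=\frac12\partial_r^2\rho$ on $[0,1]$ with Neumann boundary conditions, $G^{\rm neum}_t(r,r')=\sum_kG_t(r,r'_k)$ with $G_t(r,r')=e^{-(r-r')^2/2t}/\sqrt{2\pi t}$ and $r'_k$ the images of $r'$ under repeated reflections of $[0,1]$. For $u=cD_0+\rho$, $(G^{\rm neum}_\delta*u)(r)=cG^{\rm neum}_\delta(r,0)+\int_0^1G^{\rm neum}_\delta(r,r')\rho(r')dr'$. The cut-and-paste map is $K^{(\delta)}u=j\delta D_0+\mathbf 1_{r\in[0,R^{(\delta)}_u]}u$ with $\int_{R^{(\delta)}_u}^1u=j\delta$, and $S^{(\delta,-)}_\delta(u)=K^{(\delta)}(G^{\rm neum}_\delta*u)$. *)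

theory Defs
  imports "HOL-Analysis.Analysis"
begin

definition heat_kernel :: "real \<Rightarrow> real \<Rightarrow> real \<Rightarrow> real" where
  "heat_kernel t r r' = exp (- ((r - r')^2) / (2 * t)) / sqrt (2 * pi * t)"

text \<open>Neumann Green function on [0,1]: sum over all images of r' under repeated
  reflections of [0,1], i.e. the points 2k + r' and 2k - r' (k integer).\<close>
definition neum_green :: "real \<Rightarrow> real \<Rightarrow> real \<Rightarrow> real" where
  "neum_green t r r' =
     infsum (\<lambda>k::int. heat_kernel t r (2 * of_int k + r') + heat_kernel t r (2 * of_int k - r')) UNIV"

text \<open>Density of G^neum_delta * u for u = c D_0 + rho (rho a density on [0,1]).\<close>
definition neum_conv :: "real \<Rightarrow> real \<Rightarrow> (real \<Rightarrow> real) \<Rightarrow> real \<Rightarrow> real" where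
  "neum_conv t c \<rho> r = c * neum_green t r 0 + integral {0..1} (\<lambda>r'. neum_green t r r' * \<rho> r')"

definition cut_point :: "real \<Rightarrow> real \<Rightarrow> (real \<Rightarrow> real) \<Rightarrow> real" where
  "cut_point j \<delta> v = (THE R. R \<in> {0..1} \<and> integral {R..1} v = j * \<delta>)"

text \<open>rho is an admissible fixed-point density: u = j delta D_0 + rho satisfies
  S^{(delta,-)}_delta(u) = u, with cut point R_delta = 1 - A delta.
  Since G*u has no atom, K(G*u) = j delta D_0 + 1_{[0,R]}(G*u); the atoms match,
  and equality of the absolutely continuous parts is the pointwise identity below.\<close>
definition fixed_density :: "real \<Rightarrow> real \<Rightarrow> real \<Rightarrow> (real \<Rightarrow> real) \<Rightarrow> bool" where
  "fixed_density j A \<delta> \<rho> \<longleftrightarrow>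
     (\<forall>r\<in>{0..1}. 0 \<le> \<rho> r) \<and>
     continuous_on {0..1 - A * \<delta>} \<rho> \<and>
     (\<forall>r\<in>{1 - A * \<delta><..1}. \<rho> r = 0) \<and>
     cut_point j \<delta> (neum_conv \<delta> (j * \<delta>) \<rho>) = 1 - A * \<delta> \<and>
     (\<forall>r\<in>{0..1}. \<rho> r =
        (if r \<le> cut_point j \<delta> (neum_conv \<delta> (j * \<delta>) \<rho>)
         then neum_conv \<delta> (j * \<delta>) \<rho> r else 0))"

end

theory Submission
  imports Defs "HOL-Probability.Characteristic_Functions"
begin

text \<open>
  Write \<open>v = G * u\<close> with the Neumann kernel \<open>G\<close>.  The fixed-point equation reads
  \<open>v = j\<delta> G(\<cdot>, 0) + T v\<close> on \<open>[0, 1]\<close>, where \<open>T\<close> integrates the kernel over \<open>[0, R]\<close> only; positivity of the kernel beyond \<open>R\<close> makes \<open>T\<close> a strict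
  contraction, and conservation of mass forces \<open>\<integral>\<^sub>R\<^sup>1 v = j\<delta>\<close>, so that \<open>R\<close> is the cut point.

  For the limit, the cosine coefficients of \<open>v\<close> satisfy
  \<open>a\<^sub>n (exp (\<delta>(\<pi>n)\<^sup>2/2) - 1) = j\<delta> - b\<^sub>n\<close>, where \<open>b\<^sub>n\<close> is the coefficient of the mass removed from
  \<open>[1 - A\<delta>, 1]\<close>, i.e. nearly \<open>(-1)\<^sup>n j\<delta>\<close>.  Hence \<open>a\<^sub>n\<close> tends to the coefficient of \<open>2j(1 - r)\<close>,
  dominated by a multiple of \<open>1/n\<^sup>2\<close>, and \<open>v\<close> minus its mean converges uniformly.  The mean itself
  is found by averaging \<open>v\<close> over \<open>[1 - A\<delta>, 1]\<close>, where this average is exactly \<open>j/A\<close>.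
\<close>

section \<open>The Neumann kernel\<close>

text \<open>The substitution y = r + s x with s = \<open>sqrt t\<close> turns the heat kernel into
  the standard normal density. The claim is then the real part of the Gaussian characteristic
  function at \<open>\<omega> * s\<close>, multiplied by the phase exp(i \<omega> r).\<close>

lemma gaussian_cos_integral:
  fixes t r \<omega> :: real
  assumes "t > 0"
  shows "has_bochner_integral lborel (\<lambda>y. heat_kernel t r y * cos (\<omega> * y))
           (exp (- t * \<omega>\<^sup>2 / 2) * cos (\<omega> * r))"
proof -
  define s where "s = sqrt t"
  have s: "s > 0" "s^2 = t" using assms by (auto simp: s_def)
  let ?f = "\<lambda>x. std_normal_density x *\<^sub>R iexp (\<omega> * s * x)"
  have int: "integrable lborel ?f"
    by (rule Bochner_Integration.integrable_bound[OF integrable_std_normal_moment[of 0]])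
       (auto simp: norm_mult)
  have "(CLINT x|lborel. ?f x) = char std_normal_distribution (\<omega> * s)"
    unfolding char_def by (subst integral_density) auto
  also have "\<dots> = complex_of_real (exp (- ((\<omega> * s)\<^sup>2) / 2))"
    by (simp add: char_std_normal_distribution)
  finally have "has_bochner_integral lborel ?f (complex_of_real (exp (- ((\<omega> * s)\<^sup>2) / 2)))"
    using int by (simp add: has_bochner_integral_iff)
  then have "has_bochner_integral lborel (\<lambda>x. Re (iexp (\<omega> * r) * ?f x))
      (Re (iexp (\<omega> * r) * complex_of_real (exp (- ((\<omega> * s)\<^sup>2) / 2))))"
    by (intro has_bochner_integral_bounded_linear[OF bounded_linear_Re] has_bochner_integral_mult_right)
  moreover have "Re (iexp (\<omega> * r) * ?f x) = s * (heat_kernel t r (r + s * x) * cos (\<omega> * (r + s * x)))" for x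
  proof -
    have "sqrt (2 * pi * t) = sqrt (2 * pi) * s" by (simp add: s_def real_sqrt_mult)
    moreover have "(s * x)\<^sup>2 / (2 * t) = x\<^sup>2 / 2" using s assms by (simp add: power_mult_distrib)
    ultimately have "s * heat_kernel t r (r + s * x) = std_normal_density x"
      using s by (simp add: heat_kernel_def std_normal_density_def field_simps)
    moreover have "Re (iexp (\<omega> * r) * ?f x) = std_normal_density x * cos (\<omega> * (r + s * x))"
      by (simp add: Re_exp Im_exp cos_add algebra_simps)
    ultimately show ?thesis by (simp only: mult.assoc [symmetric])
  qed
  ultimately have "has_bochner_integral lborel
      (\<lambda>x. s * (heat_kernel t r (r + s * x) * cos (\<omega> * (r + s * x))))
      (cos (\<omega> * r) * exp (- ((\<omega> * s)\<^sup>2) / 2))"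
    by (simp add: Re_exp)
  then have "has_bochner_integral lborel
      (\<lambda>x. heat_kernel t r (r + s * x) * cos (\<omega> * (r + s * x)))
      (cos (\<omega> * r) * exp (- ((\<omega> * s)\<^sup>2) / 2) / \<bar>s\<bar>)"
    using s by (simp add: has_bochner_integral_iff field_simps)
  also have "cos (\<omega> * r) * exp (- ((\<omega> * s)\<^sup>2) / 2) / \<bar>s\<bar> = (exp (- t * \<omega>\<^sup>2 / 2) * cos (\<omega> * r)) /\<^sub>R \<bar>s\<bar>"
  proof -
    have "(\<omega> * s)\<^sup>2 = t * \<omega>\<^sup>2" using s(2) by (simp add: power_mult_distrib)
    then show ?thesis using s(1) by (simp add: field_simps)
  qed
  finally show ?thesis
    using s lborel_has_bochner_integral_real_affine_iff[of s "\<lambda>y. heat_kernel t r y * cos (\<omega> * y)" _ r]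
    by simp
qed

text \<open>Dominated convergence, with f itself as the majorant. The windows are chosen because the
  image points 2k + s and 2k - s with |k| \<le> N and s in [0,1] sweep out exactly
  [-(2N+1), 2N+1].\<close>

lemma tendsto_symmetric_integral:
  fixes f :: "real \<Rightarrow> real"
  assumes f: "has_bochner_integral lborel f I"
  shows "(\<lambda>N. integral {- (2 * real N + 1)..2 * real N + 1} f) \<longlonglongrightarrow> I"
proof -
  have int: "integrable lborel f" and I: "integral\<^sup>L lborel f = I"
    using f by (auto simp: has_bochner_integral_iff)
  let ?S = "\<lambda>N. {- (2 * real N + 1)..2 * real N + 1}"
  have "(\<lambda>N. LINT x|lborel. indicat_real (?S N) x *\<^sub>R f x) \<longlonglongrightarrow> integral\<^sup>L lborel f"
  proof (rule integral_dominated_convergence[where w = "\<lambda>x. norm (f x)"])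
    show "AE x in lborel. (\<lambda>N. indicat_real (?S N) x *\<^sub>R f x) \<longlonglongrightarrow> f x"
    proof (rule AE_I2)
      fix x :: real
      obtain n :: nat where n: "\<bar>x\<bar> \<le> real n" using real_arch_simple by blast
      have "\<forall>\<^sub>F N in sequentially. indicat_real (?S N) x *\<^sub>R f x = f x"
        using eventually_ge_at_top[of n] by eventually_elim (use n in \<open>auto simp: indicator_def\<close>)
      then show "(\<lambda>N. indicat_real (?S N) x *\<^sub>R f x) \<longlonglongrightarrow> f x"
        by (rule tendsto_eventually)
    qed
  qed (use int in \<open>auto simp: indicator_def\<close>)
  moreover have "(LINT x|lborel. indicat_real (?S N) x *\<^sub>R f x) = integral (?S N) f" for N
    using set_borel_integral_eq_integral(2)[of "?S N" f] integrable_mult_indicator[OF _ int, of "?S N"]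
    by (simp add: set_lebesgue_integral_def set_integrable_def)
  ultimately show ?thesis by (simp add: I)
qed

lemma sum_telescope_symmetric_int:
  fixes F :: "real \<Rightarrow> real"
  shows "(\<Sum>k = - int N..int N. F (2 * of_int k + 1) - F (2 * of_int k - 1))
    = F (2 * real N + 1) - F (- (2 * real N + 1))"
proof (induction N)
  case (Suc N)
  have "{- int (Suc N)..int (Suc N)} = insert (int (Suc N)) (insert (- int (Suc N)) {- int N..int N})"
    by auto
  then show ?case using Suc by (simp add: algebra_simps)
qed simp

text \<open>The k-th summand unfolds to the integral of f over [2k-1, 2k+1], and these intervals
  tile the window. With an antiderivative F, the function F(2k+s) - F(2k-s) has the integrand as its
  derivative, so the sum telescopes.\<close>

lemma integral_reflections:
  fixes f :: "real \<Rightarrow> real"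
  assumes f: "continuous_on UNIV f"
  shows "(\<Sum>k = - int N..int N. integral {0..1} (\<lambda>s. f (2 * of_int k + s) + f (2 * of_int k - s)))
    = integral {- (2 * real N + 1)..2 * real N + 1} f"
proof -
  \<comment> \<open>One unit beyond the window, so that F has a two-sided derivative at every point
    that occurs, including the endpoints.\<close>
  let ?L = "2 * real N + 2"
  obtain F where F: "\<And>x. x \<in> {-?L..?L} \<Longrightarrow> (F has_vector_derivative f x) (at x within {-?L..?L})"
    using antiderivative_continuous[of "-?L" ?L f] continuous_on_subset[OF f] by blast
  have F': "(F has_real_derivative f x) (at x)" if "\<bar>x\<bar> < ?L" for x
    using F[of x] that by (auto simp: at_within_Icc_at has_real_derivative_iff_has_vector_derivative abs_less_iff)
  have "integral {0..1} (\<lambda>s. f (2 * of_int k + s) + f (2 * of_int k - s))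
      = F (2 * of_int k + 1) - F (2 * of_int k - 1)" if k: "k \<in> {- int N..int N}" for k
  proof -
    have b: "\<bar>of_int k\<bar> \<le> real N" using k by auto
    have "((\<lambda>s. f (2 * of_int k + s) + f (2 * of_int k - s)) has_integral
        (F (2 * of_int k + 1) - F (2 * of_int k - 1)) - (F (2 * of_int k + 0) - F (2 * of_int k - 0))) {0..1}"
    proof (rule fundamental_theorem_of_calculus)
      fix s :: real assume s: "s \<in> {0..1}"
      have "((\<lambda>s. F (2 * of_int k + s) - F (2 * of_int k - s)) has_real_derivative
          f (2 * of_int k + s) * 1 - f (2 * of_int k - s) * (-1)) (at s within {0..1})"
        by (intro DERIV_diff DERIV_chain2[of F] F') (use s b in \<open>auto intro!: derivative_eq_intros\<close>)
      then show "((\<lambda>s. F (2 * of_int k + s) - F (2 * of_int k - s)) has_vector_derivative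
          f (2 * of_int k + s) + f (2 * of_int k - s)) (at s within {0..1})"
        by (simp add: has_real_derivative_iff_has_vector_derivative)
    qed simp
    then show ?thesis by (simp add: integral_unique)
  qed
  then have "(\<Sum>k = - int N..int N. integral {0..1} (\<lambda>s. f (2 * of_int k + s) + f (2 * of_int k - s)))
    = F (2 * real N + 1) - F (- (2 * real N + 1))"
    by (simp add: sum_telescope_symmetric_int)
  moreover have "(f has_integral F (2 * real N + 1) - F (- (2 * real N + 1))) {- (2 * real N + 1)..2 * real N + 1}"
    by (rule fundamental_theorem_of_calculus)
       (auto intro!: has_vector_derivative_at_within[OF F'[unfolded has_real_derivative_iff_has_vector_derivative]])
  ultimately show ?thesis by (simp add: integral_unique)
qed

section \<open>The image series: convergence, continuity, symmetry and action on cosines\<close>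

definition image_pair :: "real \<Rightarrow> real \<Rightarrow> real \<Rightarrow> int \<Rightarrow> real" where
  "image_pair t r s k = heat_kernel t r (2 * of_int k + s) + heat_kernel t r (2 * of_int k - s)"

lemma neum_green_eq_infsum: "neum_green t r s = (\<Sum>\<^sub>\<infinity>k. image_pair t r s k)"
  by (simp add: neum_green_def image_pair_def)

lemma heat_kernel_pos: "t > 0 \<Longrightarrow> heat_kernel t r s > 0"
  by (simp add: heat_kernel_def)

text \<open>An inverse-square majorant in k is enough for the M-test, so exp x \<ge> 1 + x suffices
  in place of a sharp Gaussian tail. The distance hypothesis is what the images 2k + s and 2k - s
  satisfy for r and s in [0,1].\<close>

lemma heat_kernel_bound:
  assumes "t > 0" and z: "2 * \<bar>of_int k\<bar> - 2 \<le> \<bar>r - y\<bar>"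
  shows "heat_kernel t r y \<le> (8 + t) / sqrt (2 * pi * t) / (1 + \<bar>of_int k\<bar>)\<^sup>2"
proof -
  define z where "z = \<bar>r - y\<bar>"
  have "(1 + \<bar>of_int k :: real\<bar>)\<^sup>2 \<le> (2 + z / 2)\<^sup>2" using z by (intro power_mono) (auto simp: z_def)
  also have "\<dots> \<le> 8 + z\<^sup>2 / 2"
    using zero_le_power2[of "z / 2 - 2"] by (simp add: power2_eq_square algebra_simps)
  finally have k: "(1 + \<bar>of_int k :: real\<bar>)\<^sup>2 \<le> 8 + z\<^sup>2 / 2" .
  have "1 + z\<^sup>2 / (2 * t) \<le> exp (z\<^sup>2 / (2 * t))" by (rule exp_ge_add_one_self)
  then have "exp (- (z\<^sup>2 / (2 * t))) \<le> 1 / (1 + z\<^sup>2 / (2 * t))"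
    using assms by (simp add: exp_minus divide_simps add_pos_nonneg mult.commute)
  also have "\<dots> = 2 * t / (2 * t + z\<^sup>2)" using assms by (simp add: field_simps)
  also have "\<dots> \<le> (8 + t) / (8 + z\<^sup>2 / 2)"
  proof -
    have "0 < 2 * t + z\<^sup>2" "0 < 8 + z\<^sup>2 / 2" using assms by (auto intro: add_pos_nonneg)
    then show ?thesis using assms by (simp add: field_simps power2_eq_square add_pos_nonneg)
  qed
  also have "\<dots> \<le> (8 + t) / (1 + \<bar>of_int k\<bar>)\<^sup>2"
    using k assms by (intro divide_left_mono) (auto intro!: mult_pos_pos add_pos_nonneg)
  finally show ?thesis
    using assms by (simp add: heat_kernel_def z_def field_simps)
qed

lemma summable_on_int_inverse_square: "(\<lambda>k::int. c / (1 + \<bar>of_int k :: real\<bar>)\<^sup>2) summable_on UNIV"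
proof -
  let ?g = "\<lambda>k::int. c / (1 + \<bar>of_int k :: real\<bar>)\<^sup>2"
  have "summable (\<lambda>n. inverse (real (Suc n) ^ 2))"
    using inverse_power_summable[of 2, where ?'a = real] by (subst summable_Suc_iff) auto
  then have "summable (\<lambda>n. norm (c * inverse (real (Suc n) ^ 2)))"
    by (auto simp: abs_mult intro!: summable_mult)
  then have "(\<lambda>n. c * inverse (real (Suc n) ^ 2)) summable_on UNIV"
    by (rule norm_summable_imp_summable_on)
  then have "(?g \<circ> int) summable_on UNIV" "(?g \<circ> (\<lambda>n. - int n)) summable_on UNIV"
    by (simp_all add: o_def field_simps)
  then have "?g summable_on range int" "?g summable_on range (\<lambda>n. - int n)"
    by (auto simp: summable_on_reindex inj_on_def)
  then have "?g summable_on (range int \<union> range (\<lambda>n. - int n))"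
    by (rule summable_on_union)
  moreover have "range int \<union> range (\<lambda>n. - int n) = UNIV"
    by (auto simp: image_iff) (metis int_cases2)
  ultimately show ?thesis by simp
qed

context
  fixes t :: real
  assumes t: "t > 0"
begin

lemma image_pair_pos: "image_pair t r s k > 0"
  using heat_kernel_pos[OF t] by (simp add: image_pair_def add_pos_pos)

lemma image_pair_bound:
  assumes "r \<in> {0..1}" "s \<in> {0..1}"
  shows "norm (image_pair t r s k) \<le> 2 * ((8 + t) / sqrt (2 * pi * t)) / (1 + \<bar>of_int k\<bar>)\<^sup>2"
proof -
  have "2 * \<bar>of_int k\<bar> - 2 \<le> \<bar>r - (2 * of_int k + s)\<bar>" "2 * \<bar>of_int k\<bar> - 2 \<le> \<bar>r - (2 * of_int k - s)\<bar>"
    using assms by auto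
  from this[THEN heat_kernel_bound[OF t]] show ?thesis
    using image_pair_pos[of r s k] by (simp add: image_pair_def add_divide_distrib)
qed

lemma image_pair_summable:
  assumes "r \<in> {0..1}" "s \<in> {0..1}"
  shows "image_pair t r s summable_on UNIV"
proof (rule summable_on_comparison_test[OF summable_on_int_inverse_square])
  show "image_pair t r s k \<le> 2 * ((8 + t) / sqrt (2 * pi * t)) / (1 + \<bar>of_int k\<bar>)\<^sup>2" for k
    using image_pair_bound[OF assms, of k] by simp
qed (simp add: less_imp_le image_pair_pos)

text \<open>The M-test gives uniform convergence along the net of finite index sets. Every finite
  set of integers lies in some {-N..N}, so the symmetric partial sums inherit it; as a sequence they
  allow termwise integration and passage of continuity to the limit.\<close>

lemma neum_green_uniform_limit:
  "uniform_limit ({0..1} \<times> {0..1}) (\<lambda>N (r, s). \<Sum>k = - int N..int N. image_pair t r s k)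
     (\<lambda>(r, s). neum_green t r s) sequentially"
proof -
  have *: "uniform_limit ({0..1} \<times> {0..1}) (\<lambda>X (r, s). \<Sum>k\<in>X. image_pair t r s k)
     (\<lambda>(r, s). neum_green t r s) (finite_subsets_at_top UNIV)"
    unfolding neum_green_eq_infsum case_prod_unfold
    by (rule Weierstrass_m_test_general[OF _ summable_on_int_inverse_square]) (rule image_pair_bound, auto)
  have "filterlim (\<lambda>N. {- int N..int N}) (finite_subsets_at_top UNIV) sequentially"
  proof (rule filterlim_finite_subsets_at_top[THEN iffD2, rule_format])
    fix X :: "int set" assume X: "finite X \<and> X \<subseteq> UNIV"
    then have "bdd_above (abs ` X)" by simp
    then obtain b where "\<forall>x\<in>X. \<bar>x\<bar> \<le> b"
      unfolding bdd_above_def by blast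
    then have "\<forall>x\<in>X. x \<in> {- int N..int N}" if "N \<ge> nat b" for N
      using that by (force simp: abs_le_iff)
    then show "\<forall>\<^sub>F N in sequentially. finite {- int N..int N} \<and> X \<subseteq> {- int N..int N} \<and> {- int N..int N} \<subseteq> UNIV"
      by (intro eventually_sequentiallyI[of "nat b"]) blast
  qed
  from filterlim_compose[OF * this] show ?thesis by simp
qed

lemma neum_green_tendsto:
  assumes "r \<in> {0..1}" "s \<in> {0..1}"
  shows "(\<lambda>N. \<Sum>k = - int N..int N. image_pair t r s k) \<longlonglongrightarrow> neum_green t r s"
  using tendsto_uniform_limitI[OF neum_green_uniform_limit, of "(r, s)"] assms by simp

lemma neum_green_continuous:
  "continuous_on ({0..1} \<times> {0..1}) (\<lambda>(r, s). neum_green t r s)"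
proof (rule uniform_limit_theorem[OF _ neum_green_uniform_limit])
  show "\<forall>\<^sub>F N in sequentially. continuous_on ({0..1} \<times> {0..1}) (\<lambda>(r, s). \<Sum>k = - int N..int N. image_pair t r s k)"
    using t unfolding image_pair_def heat_kernel_def case_prod_unfold
    by (intro always_eventually allI continuous_intros) auto
qed simp

lemma neum_green_pos:
  assumes "r \<in> {0..1}" "s \<in> {0..1}"
  shows "neum_green t r s > 0"
proof -
  have "(\<Sum>k\<in>{0}. image_pair t r s k) \<le> neum_green t r s"
    unfolding neum_green_eq_infsum
    by (rule finite_sum_le_infsum) (auto simp: image_pair_summable[OF assms] less_imp_le[OF image_pair_pos])
  then show ?thesis using image_pair_pos[of r s 0] by simp
qed

text \<open>The terms at 2k - s are symmetric in r and s one by one; those at 2k + s are exchanged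
  by k -> -k, which preserves the symmetric partial sums.\<close>

lemma neum_green_commute:
  assumes "r \<in> {0..1}" "s \<in> {0..1}"
  shows "neum_green t r s = neum_green t s r"
proof -
  have "(\<Sum>k = - int N..int N. image_pair t r s k) = (\<Sum>k = - int N..int N. image_pair t s r k)" for N
  proof -
    have "(\<Sum>k = - int N..int N. heat_kernel t r (2 * of_int k + s))
        = (\<Sum>k = - int N..int N. heat_kernel t s (2 * of_int k + r))"
      by (rule sum.reindex_bij_witness[of _ uminus uminus])
         (auto simp: heat_kernel_def power2_eq_square algebra_simps)
    moreover have "heat_kernel t r (2 * of_int k - s) = heat_kernel t s (2 * of_int k - r)" for k :: int
      by (simp add: heat_kernel_def power2_eq_square algebra_simps)
    ultimately show ?thesis by (simp add: image_pair_def sum.distrib)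
  qed
  then show ?thesis
    using LIMSEQ_unique neum_green_tendsto[OF assms] neum_green_tendsto[OF assms(2,1)] by simp
qed

text \<open>The functions cos(\<pi> n s) are even and 2-periodic, so the cosine takes the same value
  at s and at all its images. The sum over images then unfolds to the Gaussian integral over the
  line. The case n = 0 is conservation of mass.\<close>

lemma neum_green_cos_integral:
  assumes r: "r \<in> {0..1}"
  shows "integral {0..1} (\<lambda>s. neum_green t r s * cos (pi * real n * s))
    = exp (- t * (pi * real n)\<^sup>2 / 2) * cos (pi * real n * r)"
proof -
  let ?w = "pi * real n"
  let ?f = "\<lambda>y. heat_kernel t r y * cos (?w * y)"
  let ?P = "\<lambda>N s. (\<Sum>k = - int N..int N. image_pair t r s k) * cos (?w * s)"
  have cont: "continuous_on S (\<lambda>y. heat_kernel t r y)" for S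
    using t unfolding heat_kernel_def by (intro continuous_intros) auto
  have cont2 [continuous_intros]: "continuous_on S (\<lambda>s. image_pair t r s k)" for S k
    using t unfolding image_pair_def heat_kernel_def by (intro continuous_intros) auto
  have cosk: "cos (?w * (2 * of_int k + s)) = cos (?w * s)"
             "cos (?w * (2 * of_int k - s)) = cos (?w * s)" for k :: int and s
  proof -
    have "?w * (2 * of_int k + s) = ?w * s + 2 * pi * of_int (k * int n)"
         "?w * (2 * of_int k - s) = - (?w * s) + 2 * pi * of_int (k * int n)"
      by (simp_all add: algebra_simps)
    then show "cos (?w * (2 * of_int k + s)) = cos (?w * s)"
             "cos (?w * (2 * of_int k - s)) = cos (?w * s)"
      using cos_add[of _ "2 * pi * of_int (k * int n)"] by (simp_all only: cos_int_2pin sin_int_2pin) simp_all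
  qed
  have "uniform_limit {0..1} (\<lambda>N s. \<Sum>k = - int N..int N. image_pair t r s k) (neum_green t r) sequentially"
    using uniform_limit_compose'[OF neum_green_uniform_limit, of "\<lambda>s. (r, s)" "{0..1}"] r by auto
  moreover have "uniform_limit {0..1} (\<lambda>N s. cos (?w * s)) (\<lambda>s. cos (?w * s)) sequentially"
    by (rule uniform_limit_const)
  moreover have "bounded (neum_green t r ` {0..1})"
    by (intro compact_imp_bounded compact_continuous_image
        continuous_on_compose2[OF neum_green_continuous, of _ "\<lambda>s. (r, s)", simplified])
       (use r in \<open>auto intro!: continuous_intros\<close>)
  moreover have "bounded ((\<lambda>s. cos (?w * s)) ` {0..1})"
    by (rule boundedI[of _ 1]) auto
  ultimately have u: "uniform_limit {0..1} ?P (\<lambda>s. neum_green t r s * cos (?w * s)) sequentially"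
    by (intro uniform_lim_mult)
  obtain I J where I: "\<And>N. (?P N has_integral I N) {0..1}"
    and J: "((\<lambda>s. neum_green t r s * cos (?w * s)) has_integral J) {0..1}" and "I \<longlonglongrightarrow> J"
    by (rule uniform_limit_integral[OF u]) (auto intro!: continuous_intros)
  have I_eq: "I N = integral {- (2 * real N + 1)..2 * real N + 1} ?f" for N
  proof -
    have "?P N s = (\<Sum>k = - int N..int N. ?f (2 * of_int k + s) + ?f (2 * of_int k - s))" for s
      by (simp add: cosk image_pair_def sum_distrib_right distrib_right)
    then have "integral {0..1} (?P N)
        = integral {0..1} (\<lambda>s. \<Sum>k = - int N..int N. ?f (2 * of_int k + s) + ?f (2 * of_int k - s))"
      by simp
    also have "\<dots> = (\<Sum>k = - int N..int N. integral {0..1} (\<lambda>s. ?f (2 * of_int k + s) + ?f (2 * of_int k - s)))"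
      by (intro integral_sum integrable_continuous_real continuous_intros
          continuous_on_compose2[OF cont[of UNIV]]) auto
    also have "\<dots> = integral {- (2 * real N + 1)..2 * real N + 1} ?f"
      by (intro integral_reflections continuous_intros cont)
    finally show ?thesis using I[of N] by (simp add: integral_unique)
  qed
  have "I \<longlonglongrightarrow> exp (- t * ?w\<^sup>2 / 2) * cos (?w * r)"
    using tendsto_symmetric_integral[OF gaussian_cos_integral[OF t, of r ?w]] by (simp only: I_eq[abs_def])
  with \<open>I \<longlonglongrightarrow> J\<close> have "J = exp (- t * ?w\<^sup>2 / 2) * cos (?w * r)"
    by (rule LIMSEQ_unique)
  then show ?thesis using J by (simp add: integral_unique)
qed

end

section \<open>Cosine expansions on the unit interval\<close>

text \<open>Integer rather than natural frequencies, because the product-to-sum formula below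
  produces m - n.\<close>

lemma integral_cos_pi_int:
  "integral {0..1} (\<lambda>r. cos (pi * of_int k * r)) = (if k = 0 then 1 else 0)"
proof (cases "k = 0")
  case False
  have "((\<lambda>r. cos (pi * of_int k * r)) has_integral
      sin (pi * of_int k * 1) / (pi * of_int k) - sin (pi * of_int k * 0) / (pi * of_int k)) {0..1}"
    by (rule fundamental_theorem_of_calculus)
       (use False in \<open>auto intro!: derivative_eq_intros simp flip: has_real_derivative_iff_has_vector_derivative\<close>)
  moreover have "sin (pi * of_int k) = 0" by (metis mult.commute sin_times_pi_eq_0 Ints_of_int)
  ultimately show ?thesis using False by (simp add: integral_unique)
qed simp

lemma integral_cos_cos:
  "integral {0..1} (\<lambda>r. cos (pi * real m * r) * cos (pi * real n * r))
    = (if m = n then if m = 0 then 1 else 1 / 2 else 0)"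
proof -
  have "cos (pi * real m * r) * cos (pi * real n * r)
      = (cos (pi * of_int (int m - int n) * r) + cos (pi * of_int (int m + int n) * r)) / 2" for r
    by (simp add: cos_times_cos algebra_simps)
  then have "integral {0..1} (\<lambda>r. cos (pi * real m * r) * cos (pi * real n * r))
    = (integral {0..1} (\<lambda>r. cos (pi * of_int (int m - int n) * r))
       + integral {0..1} (\<lambda>r. cos (pi * of_int (int m + int n) * r))) / 2"
    by (simp only: integral_divide)
       (intro arg_cong2[where f = "(/)"] refl integral_add integrable_continuous_real continuous_intros)
  then show ?thesis unfolding integral_cos_pi_int by auto
qed

text \<open>The span of the functions \<open>cos (\<pi> n r)\<close> is the algebra of polynomials in \<open>cos (\<pi> r)\<close>,
  so completeness reduces to Weierstrass approximation in the variable \<open>x = cos (\<pi> r)\<close>.\<close>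

lemma cos_coefficients_zero_imp_zero:
  fixes f :: "real \<Rightarrow> real"
  assumes f: "continuous_on {0..1} f"
    and coeff: "\<And>n. integral {0..1} (\<lambda>r. f r * cos (pi * real n * r)) = 0"
    and r: "r \<in> {0..1}"
  shows "f r = 0"
proof -
  note [continuous_intros] = f
  have pow: "integral {0..1} (\<lambda>r. f r * cos (pi * r) ^ m * cos (pi * real n * r)) = 0" for m n
  proof (induction m arbitrary: n)
    case (Suc m)
    \<comment> \<open>\<open>n'\<close> is |n - 1|: multiplying by cos(\<pi> r) averages the
      frequencies n + 1 and n - 1, and for n = 0 the frequency -1 equals 1 by evenness.\<close>
    define n' where "n' = (if n = 0 then 1 else n - 1)"
    have "cos (pi * r) * cos (pi * real n * r) = (cos (pi * real (n + 1) * r) + cos (pi * real n' * r)) / 2" for r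
      by (cases n) (simp_all add: n'_def cos_times_cos algebra_simps)
    then have "f r * cos (pi * r) ^ m * (cos (pi * r) * cos (pi * real n * r))
      = f r * cos (pi * r) ^ m * cos (pi * real (n + 1) * r) / 2 + f r * cos (pi * r) ^ m * cos (pi * real n' * r) / 2" for r
      by (simp only:) (simp add: distrib_left add_divide_distrib)
    moreover have "f r * cos (pi * r) ^ Suc m * cos (pi * real n * r)
      = f r * cos (pi * r) ^ m * (cos (pi * r) * cos (pi * real n * r))" for r
      by simp
    ultimately have "integral {0..1} (\<lambda>r. f r * cos (pi * r) ^ Suc m * cos (pi * real n * r))
      = integral {0..1} (\<lambda>r. f r * cos (pi * r) ^ m * cos (pi * real (n + 1) * r) / 2)
      + integral {0..1} (\<lambda>r. f r * cos (pi * r) ^ m * cos (pi * real n' * r) / 2)"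
      by (simp only:) (intro integral_add integrable_continuous_real continuous_intros; simp)
    then show ?case by (simp only: integral_divide Suc)
  qed (simp add: coeff)
  have poly: "integral {0..1} (\<lambda>r. f r * p (cos (pi * r))) = 0" if p: "real_polynomial_function p" for p
  proof -
    obtain a n where "p = (\<lambda>x. \<Sum>i\<le>n. a i * x ^ i)"
      using p unfolding real_polynomial_function_iff_sum by blast
    then have "integral {0..1} (\<lambda>r. f r * p (cos (pi * r)))
        = integral {0..1} (\<lambda>r. \<Sum>i\<le>n. a i * (f r * cos (pi * r) ^ i))"
      by (simp add: sum_distrib_left mult_ac)
    also have "\<dots> = (\<Sum>i\<le>n. integral {0..1} (\<lambda>r. a i * (f r * cos (pi * r) ^ i)))"
      by (intro integral_sum integrable_continuous_real continuous_intros) auto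
    finally show ?thesis using pow[of _ 0] by simp
  qed
  have sq: "integral {0..1} (\<lambda>r. f r * f r) \<le> e * integral {0..1} (\<lambda>r. \<bar>f r\<bar>)" if e: "e > 0" for e
  proof -
    have "continuous_on {-1..1} (\<lambda>x. f (arccos x / pi))"
      by (intro continuous_on_compose2[OF f] continuous_intros) (auto simp: arccos_lbound arccos_ubound)
    then obtain p where p: "real_polynomial_function p" "\<And>x. x \<in> {-1..1} \<Longrightarrow> \<bar>f (arccos x / pi) - p x\<bar> < e"
      using Stone_Weierstrass_real_polynomial_function[of "{-1..1}" "\<lambda>x. f (arccos x / pi)" e] e by auto
    have pc: "continuous_on S p" for S
      using p(1) by (simp add: continuous_on_polymonial_function real_polynomial_function_eq)
    have fp: "\<bar>f r - p (cos (pi * r))\<bar> \<le> e" if "r \<in> {0..1}" for r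
      using p(2)[of "cos (pi * r)"] that by (simp add: arccos_cos)
    have [continuous_intros]: "continuous_on {0..1} (\<lambda>r. p (cos (pi * r)))"
      by (intro continuous_on_compose2[OF pc[of UNIV]] continuous_intros) auto
    \<comment> \<open>Since f is orthogonal to p(cos(\<pi> r)), subtracting that product costs
      nothing, and one factor f becomes the approximation error, at most e.\<close>
    have "integral {0..1} (\<lambda>r. f r * f r)
        = integral {0..1} (\<lambda>r. f r * f r) - integral {0..1} (\<lambda>r. f r * p (cos (pi * r)))"
      using poly[OF p(1)] by simp
    also have "\<dots> = integral {0..1} (\<lambda>r. f r * f r - f r * p (cos (pi * r)))"
      by (intro integral_diff[symmetric] integrable_continuous_real continuous_intros)
    also have "\<dots> \<le> integral {0..1} (\<lambda>r. e * \<bar>f r\<bar>)"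
    proof (intro integral_le integrable_continuous_real continuous_intros)
      fix r :: real assume "r \<in> {0..1}"
      have "f r * f r - f r * p (cos (pi * r)) \<le> \<bar>f r\<bar> * \<bar>f r - p (cos (pi * r))\<bar>"
        by (simp add: abs_mult[symmetric] right_diff_distrib)
      also have "\<dots> \<le> \<bar>f r\<bar> * e" using fp[OF \<open>r \<in> {0..1}\<close>] by (rule mult_left_mono) simp
      finally show "f r * f r - f r * p (cos (pi * r)) \<le> e * \<bar>f r\<bar>" by (simp add: mult.commute)
    qed
    finally show ?thesis by simp
  qed
  define C where "C = integral {0..1} (\<lambda>r. \<bar>f r\<bar>)"
  have "C \<ge> 0" unfolding C_def by (rule integral_nonneg) (auto intro!: integrable_continuous_real continuous_intros)
  have "integral {0..1} (\<lambda>r. f r * f r) \<le> 0"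
  proof (rule field_le_epsilon)
    fix e :: real assume "e > 0"
    \<comment> \<open>\<open>C + 1\<close> rather than \<open>C\<close>, which may be 0.\<close>
    then have "integral {0..1} (\<lambda>r. f r * f r) \<le> e / (C + 1) * C"
      using sq[of "e / (C + 1)"] \<open>C \<ge> 0\<close> by (simp add: C_def)
    also have "\<dots> \<le> e" using \<open>e > 0\<close> \<open>C \<ge> 0\<close> by (simp add: field_simps)
    finally show "integral {0..1} (\<lambda>r. f r * f r) \<le> 0 + e" by simp
  qed
  moreover have "integral {0..1} (\<lambda>r. f r * f r) \<ge> 0"
    by (rule integral_nonneg) (auto intro!: integrable_continuous_real continuous_intros)
  ultimately have "integral (cbox 0 1) (\<lambda>r. f r * f r) = 0" by simp
  then have "\<forall>r\<in>cbox 0 1. f r * f r = 0"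
    by (subst (asm) integral_cbox_eq_0_iff) (auto intro!: continuous_intros)
  then show ?thesis using r by auto
qed

text \<open>Absolutely summable coefficients make the cosine series converge uniformly to a
  continuous S with the same coefficients as f; completeness gives f = S. This turns estimates of
  coefficients into uniform estimates.\<close>

lemma abs_le_suminf_cos_coefficients:
  fixes f :: "real \<Rightarrow> real"
  assumes f: "continuous_on {0..1} f"
    and sum: "summable (\<lambda>n. \<bar>integral {0..1} (\<lambda>r. f r * cos (pi * real n * r))\<bar>)"
    and r: "r \<in> {0..1}"
  shows "\<bar>f r\<bar> \<le> 2 * (\<Sum>n. \<bar>integral {0..1} (\<lambda>r. f r * cos (pi * real n * r))\<bar>)"
proof -
  define c where "c n = integral {0..1} (\<lambda>r. f r * cos (pi * real n * r))" for n
  \<comment> \<open>The weights invert the squared norms of the cosines: 1 for n = 0 and 1/2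
    otherwise.\<close>
  define w where "w n = (if n = 0 then 1 else 2 :: real)" for n :: nat
  define S where "S r = (\<Sum>n. w n * c n * cos (pi * real n * r))" for r
  have sum2: "summable (\<lambda>n. 2 * \<bar>c n\<bar>)" using sum by (intro summable_mult) (simp add: c_def)
  have bound: "norm (w n * c n * cos (pi * real n * r)) \<le> 2 * \<bar>c n\<bar>" for n r
  proof -
    have "\<bar>w n\<bar> * \<bar>c n\<bar> * \<bar>cos (pi * real n * r)\<bar> \<le> 2 * \<bar>c n\<bar> * 1"
      by (intro mult_mono) (auto simp: w_def)
    then show ?thesis by (simp add: abs_mult)
  qed
  have u: "uniform_limit {0..1} (\<lambda>N r. \<Sum>n<N. w n * c n * cos (pi * real n * r)) S sequentially"
    unfolding S_def by (rule Weierstrass_m_test[OF bound sum2])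
  have S: "continuous_on {0..1} S"
    by (rule uniform_limit_theorem[OF _ u]) (auto intro!: always_eventually continuous_intros)
  have "integral {0..1} (\<lambda>r. S r * cos (pi * real m * r)) = c m" for m
  proof -
    let ?P = "\<lambda>N r. (\<Sum>n<N. w n * c n * cos (pi * real n * r)) * cos (pi * real m * r)"
    have "uniform_limit {0..1} ?P (\<lambda>r. S r * cos (pi * real m * r)) sequentially"
      by (intro uniform_lim_mult u uniform_limit_const compact_imp_bounded compact_continuous_image S continuous_intros) auto
    then obtain I J where I: "\<And>N. (?P N has_integral I N) {0..1}"
      and J: "((\<lambda>r. S r * cos (pi * real m * r)) has_integral J) {0..1}" and "I \<longlonglongrightarrow> J"
      by (rule uniform_limit_integral) (auto intro!: continuous_intros)
    \<comment> \<open>By orthogonality the m-th coefficient of a partial sum is stationary once the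
      partial sum contains the m-th term.\<close>
    have "I N = c m" if "N > m" for N
    proof -
      have "I N = integral {0..1} (\<lambda>r. \<Sum>n<N. w n * c n * (cos (pi * real n * r) * cos (pi * real m * r)))"
        using I[of N] by (simp add: integral_unique sum_distrib_right mult.assoc)
      also have "\<dots> = (\<Sum>n<N. integral {0..1} (\<lambda>r. w n * c n * (cos (pi * real n * r) * cos (pi * real m * r))))"
        by (intro integral_sum integrable_continuous_real continuous_intros) auto
      also have "\<dots> = (\<Sum>n<N. if n = m then c m else 0)"
        by (intro sum.cong refl) (simp add: integral_cos_cos w_def)
      finally show ?thesis using that by simp
    qed
    then have "\<forall>\<^sub>F N in sequentially. I N = c m"
      by (intro eventually_sequentiallyI[of "Suc m"]) simp
    then have "I \<longlonglongrightarrow> c m" by (rule tendsto_eventually)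
    then show ?thesis using J \<open>I \<longlonglongrightarrow> J\<close> LIMSEQ_unique by (auto simp: integral_unique)
  qed
  then have "integral {0..1} (\<lambda>r. (f r - S r) * cos (pi * real m * r)) = 0" for m
    by (simp add: left_diff_distrib c_def)
       (subst integral_diff, auto intro!: integrable_continuous_real continuous_intros f S)
  then have "f r - S r = 0"
    by (intro cos_coefficients_zero_imp_zero[of "\<lambda>r. f r - S r"] continuous_intros f S r)
  then have "\<bar>f r\<bar> = norm (\<Sum>n. w n * c n * cos (pi * real n * r))" by (simp add: S_def)
  also have "\<dots> \<le> (\<Sum>n. 2 * \<bar>c n\<bar>)"
    by (rule norm_suminf_le[OF bound sum2])
  also have "\<dots> = 2 * (\<Sum>n. \<bar>c n\<bar>)"
    using sum by (intro suminf_mult) (simp add: c_def)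
  finally show ?thesis by (simp add: c_def)
qed

section \<open>The heat step followed by the cut\<close>

locale killed_heat =
  fixes t R :: real
  assumes t: "t > 0" and R: "0 \<le> R" "R < 1"
begin

abbreviation G :: "real \<Rightarrow> real \<Rightarrow> real" where "G \<equiv> neum_green t"

lemmas G_pos = neum_green_pos[OF t]
lemmas G_cont = neum_green_continuous[OF t]

lemma continuous_on_G_right: "r \<in> {0..1} \<Longrightarrow> S \<subseteq> {0..1} \<Longrightarrow> continuous_on S (G r)"
  by (rule continuous_on_compose2[OF G_cont, of S "\<lambda>s. (r, s)", simplified])
     (auto intro!: continuous_on_Pair continuous_on_const continuous_on_id)

lemma continuous_on_G_left: "s \<in> {0..1} \<Longrightarrow> continuous_on {0..1} (\<lambda>r. G r s)"
  by (rule continuous_on_compose2[OF G_cont, of "{0..1}" "\<lambda>r. (r, s)", simplified])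
     (auto intro!: continuous_on_Pair continuous_on_const continuous_on_id)

text \<open>The cut sits in the domain of integration, while \<open>T f\<close> is evaluated on all
  of [0,1]. A fixed point is thus the profile after the heat step and before the cut, which is
  continuous across R.\<close>

definition T :: "(real \<Rightarrow> real) \<Rightarrow> real \<Rightarrow> real" where
  "T f r = integral {0..R} (\<lambda>s. G r s * f s)"

lemma subset_R: "{0..R} \<subseteq> {0..1}" "{R..1} \<subseteq> {0..1}" using R by auto

lemma integrable_G:
  assumes "r \<in> {0..1}" "continuous_on {0..1} f"
  shows "(\<lambda>s. G r s * f s) integrable_on {0..R}"
  by (intro integrable_continuous_real continuous_intros continuous_on_G_right assms subset_R
      continuous_on_subset[OF assms(2) subset_R(1)])

text \<open>Continuity of f is asked for on [0,R] only, so that the lemma applies to a fixed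
  density, which may jump at R.\<close>

lemma continuous_on_T:
  assumes f: "continuous_on {0..R} f"
  shows "continuous_on {0..1} (T f)"
proof -
  have "continuous_on ({0..1} \<times> {0..R}) (\<lambda>x. G (fst x) (snd x) * f (snd x))"
    by (intro continuous_intros continuous_on_compose2[OF f]
        continuous_on_subset[OF G_cont[unfolded case_prod_unfold]]) (use R in auto)
  then show ?thesis
    using integral_continuous_on_param[of "{0..1}" 0 R "\<lambda>r s. G r s * f s"]
    by (simp add: T_def[abs_def] case_prod_unfold)
qed

text \<open>The kernel has a positive minimum g on the compact square and total mass 1, so at least
  g (1 - R) of the mass falls in [R,1], and q = 1 - g (1 - R) works.\<close>

lemma sub_markov:
  obtains q where "0 \<le> q" "q < 1"
    "\<And>r. r \<in> {0..1} \<Longrightarrow> 0 \<le> integral {0..R} (G r)" "\<And>r. r \<in> {0..1} \<Longrightarrow> integral {0..R} (G r) \<le> q"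
proof -
  obtain x0 where x0: "x0 \<in> {0..1} \<times> {0..1}"
    and min: "\<And>x. x \<in> {0..1} \<times> {0..1} \<Longrightarrow> (\<lambda>(r, s). G r s) x0 \<le> (\<lambda>(r, s). G r s) x"
    using continuous_attains_inf[OF _ _ G_cont] by (auto simp: compact_Times)
  define g where "g = (\<lambda>(r, s). G r s) x0"
  have g: "g > 0" "\<And>r s. r \<in> {0..1} \<Longrightarrow> s \<in> {0..1} \<Longrightarrow> g \<le> G r s"
    using x0 min G_pos by (auto simp: g_def case_prod_unfold)
  have int: "G r integrable_on S" if "r \<in> {0..1}" "S = {0..1} \<or> S = {0..R} \<or> S = {R..1}" for r S
    using that subset_R by (auto intro!: integrable_continuous_real continuous_on_G_right)
  have pos: "0 \<le> integral {0..R} (G r)" if "r \<in> {0..1}" for r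
    using that R less_imp_le[OF G_pos] by (intro integral_nonneg int) auto
  have le: "integral {0..R} (G r) \<le> 1 - g * (1 - R)" if r: "r \<in> {0..1}" for r
  proof -
    have "integral {0..R} (G r) + integral {R..1} (G r) = integral {0..1} (G r)"
      using R r by (intro Henstock_Kurzweil_Integration.integral_combine int) auto
    also have "\<dots> = 1" using neum_green_cos_integral[OF t r, of 0] by simp
    finally have "integral {0..R} (G r) + integral {R..1} (G r) = 1" .
    moreover have "integral {R..1} (\<lambda>s. g) \<le> integral {R..1} (G r)"
      using r R g(2) by (intro integral_le int) auto
    ultimately show ?thesis using R by (simp add: mult.commute)
  qed
  have "0 \<le> 1 - g * (1 - R)" using pos[of 0] le[of 0] by simp
  moreover have "1 - g * (1 - R) < 1" using g R by simp
  ultimately show ?thesis using that pos le by blast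
qed

text \<open>Minimum principle: at a minimiser r0 with f r0 < 0, one would have f r0 \<ge> T f r0
  \<ge> q * f r0 > f r0, because q < 1.\<close>

lemma comparison:
  assumes f: "continuous_on {0..1} f"
    and super: "\<And>r. r \<in> {0..1} \<Longrightarrow> T f r \<le> f r"
    and r: "r \<in> {0..1}"
  shows "0 \<le> f r"
proof -
  obtain r0 where r0: "r0 \<in> {0..1}" and min: "\<And>r. r \<in> {0..1} \<Longrightarrow> f r0 \<le> f r"
    using continuous_attains_inf[OF _ _ f] by auto
  obtain q where q: "0 \<le> q" "q < 1" "integral {0..R} (G r0) \<le> q"
    using sub_markov r0 by metis
  have "0 \<le> f r0"
  proof (rule ccontr)
    assume neg: "\<not> 0 \<le> f r0"
    have "integral {0..R} (\<lambda>s. G r0 s * f r0) \<le> T f r0"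
      unfolding T_def
    proof (intro integral_le integrable_G r0 f continuous_intros)
      fix s assume "s \<in> {0..R}"
      then show "G r0 s * f r0 \<le> G r0 s * f s"
        using R r0 min[of s] G_pos[of r0 s] by (intro mult_left_mono) auto
    qed
    then have "integral {0..R} (G r0) * f r0 \<le> f r0"
      using super[OF r0] by simp
    moreover have "q * f r0 \<le> integral {0..R} (G r0) * f r0"
      using q neg by (intro mult_right_mono_neg) auto
    moreover have "1 * f r0 < q * f r0"
      using q neg by (intro mult_strict_right_mono_neg) auto
    ultimately show False by simp
  qed
  then show ?thesis using min[OF r] by simp
qed

lemma T_diff:
  assumes "continuous_on {0..1} f" "continuous_on {0..1} g" "r \<in> {0..1}"
  shows "T (\<lambda>s. f s - g s) r = T f r - T g r"
  unfolding T_def right_diff_distrib by (intro integral_diff integrable_G assms)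

lemma fixed_point_unique:
  assumes f: "continuous_on {0..1} f" and g: "continuous_on {0..1} g"
    and "\<And>r. r \<in> {0..1} \<Longrightarrow> f r = h r + T f r" "\<And>r. r \<in> {0..1} \<Longrightarrow> g r = h r + T g r"
    and r: "r \<in> {0..1}"
  shows "f r = g r"
proof -
  have "0 \<le> f r - g r"
    by (rule comparison[OF continuous_on_diff[OF f g] _ r]) (simp add: T_diff[OF f g] assms(3,4))
  moreover have "0 \<le> g r - f r"
    by (rule comparison[OF continuous_on_diff[OF g f] _ r]) (simp add: T_diff[OF g f] assms(3,4))
  ultimately show ?thesis by simp
qed

text \<open>Banach's theorem in the space of bounded continuous functions on the line. Composing
  with \<open>clamp\<close> extends a function on [0,1] to the line, and T is a q-contraction in the
  sup norm by \<open>sub_markov\<close>.\<close>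

lemma fixed_point_exists:
  assumes h: "continuous_on {0..1} h"
  obtains v where "continuous_on {0..1} v" "\<And>r. r \<in> {0..1} \<Longrightarrow> v r = h r + T v r"
proof -
  obtain q where q: "0 \<le> q" "q < 1"
    and T1: "\<And>r. r \<in> {0..1} \<Longrightarrow> integral {0..R} (G r) \<le> q"
    using sub_markov by metis
  have "\<exists>F. \<forall>x. apply_bcontfun F x = h (clamp 0 1 x) + T (apply_bcontfun f) (clamp 0 1 x)"
    for f :: "real \<Rightarrow>\<^sub>C real"
  proof -
    have "continuous_on (cbox 0 1) (\<lambda>r. h r + T (apply_bcontfun f) r)"
      using h by (auto intro!: continuous_intros continuous_on_T)
    then show ?thesis by (rule continuous_on_cbox_bcontfunE) blast
  qed
  then obtain F :: "(real \<Rightarrow>\<^sub>C real) \<Rightarrow> (real \<Rightarrow>\<^sub>C real)"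
    where F: "\<And>f x. apply_bcontfun (F f) x = h (clamp 0 1 x) + T (apply_bcontfun f) (clamp 0 1 x)"
    by metis
  have "dist (F f) (F g) \<le> q * dist f g" for f g
  proof (rule dist_bound)
    fix x :: real
    define r where "r = clamp 0 1 x"
    have r: "r \<in> {0..1}" using clamp_in_interval[of 0 1 x] by (simp add: r_def)
    have i: "(\<lambda>s. G r s * c) integrable_on {0..R}" for c
      by (intro integrable_G r continuous_intros)
    have "dist (F f x) (F g x) = \<bar>T (\<lambda>s. f s - g s) r\<bar>"
      using r by (simp add: F dist_real_def T_diff flip: r_def)
    also have "\<dots> \<le> integral {0..R} (\<lambda>s. G r s * dist f g)"
      unfolding T_def
    proof (rule integral_norm_bound_integral[where 'a = real, unfolded real_norm_def])
      fix s assume s: "s \<in> {0..R}"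
      have "\<bar>f s - g s\<bar> \<le> dist f g" using dist_bounded[of f s g] by (simp add: dist_real_def)
      then show "\<bar>G r s * (f s - g s)\<bar> \<le> G r s * dist f g"
        using G_pos[of r s] r s R by (simp add: abs_mult)
    qed (auto intro!: integrable_G r continuous_intros)
    also have "\<dots> \<le> q * dist f g"
      using T1[OF r] by (simp add: mult_right_mono)
    finally show "dist (F f x) (F g x) \<le> q * dist f g" .
  qed
  then obtain f where f: "F f = f" using banach_fix_type[of q F] q by blast
  show ?thesis
  proof
    show "continuous_on {0..1} (apply_bcontfun f)" by simp
    fix r :: real assume "r \<in> {0..1}"
    then show "apply_bcontfun f r = h r + T (apply_bcontfun f) r"
      using F[of f r] by (simp add: f)
  qed
qed

text \<open>The equation for v is integrated against a cosine. Fubini and the symmetry of the kernel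
  let the cosine be integrated first, giving the eigenvalue; what remains is the coefficient over
  [0,R], which is a n - b n.\<close>

lemma cos_coefficient_equation:
  assumes v: "continuous_on {0..1} v"
    and eq: "\<And>r. r \<in> {0..1} \<Longrightarrow> v r = c * G r 0 + T v r"
  defines "a \<equiv> \<lambda>n. integral {0..1} (\<lambda>r. v r * cos (pi * real n * r))"
    and "b \<equiv> \<lambda>n. integral {R..1} (\<lambda>r. v r * cos (pi * real n * r))"
  shows "a n = exp (- t * (pi * real n)\<^sup>2 / 2) * (c + a n - b n)"
proof -
  let ?cos = "\<lambda>r. cos (pi * real n * r)" and ?l = "exp (- t * (pi * real n)\<^sup>2 / 2)"
  have G_cos: "integral {0..1} (\<lambda>r. G r s * ?cos r) = ?l * ?cos s" if "s \<in> {0..1}" for s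
  proof -
    have "integral {0..1} (\<lambda>r. G r s * ?cos r) = integral {0..1} (\<lambda>r. G s r * ?cos r)"
      using that by (intro integral_cong) (simp add: neum_green_commute[OF t])
    then show ?thesis by (simp add: neum_green_cos_integral[OF t that])
  qed
  have "integral {0..1} (\<lambda>r. T v r * ?cos r)
      = integral {0..1} (\<lambda>r. integral {0..R} (\<lambda>s. G r s * v s * ?cos r))"
    by (simp add: T_def)
  also have "\<dots> = integral {0..R} (\<lambda>s. integral {0..1} (\<lambda>r. G r s * v s * ?cos r))"
  proof -
    have "continuous_on (cbox (0, 0) (1, R)) (\<lambda>(r, s). G r s * v s * ?cos r)"
      unfolding case_prod_unfold
      by (intro continuous_intros continuous_on_compose2[OF v]
        continuous_on_subset[OF G_cont[unfolded case_prod_unfold]])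
        (use R in \<open>auto simp: cbox_Pair_eq\<close>)
    from integral_swap_continuous[OF this] show ?thesis by simp
  qed
  also have "\<dots> = integral {0..R} (\<lambda>s. v s * (?l * ?cos s))"
  proof (rule integral_cong)
    fix s assume "s \<in> {0..R}"
    then have "integral {0..1} (\<lambda>r. G r s * ?cos r) = ?l * ?cos s" using R G_cos by auto
    moreover have "G r s * v s * ?cos r = v s * (G r s * ?cos r)" for r by simp
    ultimately show "integral {0..1} (\<lambda>r. G r s * v s * ?cos r) = v s * (?l * ?cos s)"
      by (simp only: integral_mult_right)
  qed
  also have "\<dots> = ?l * integral {0..R} (\<lambda>s. v s * ?cos s)"
    by (subst integral_mult_right[symmetric], intro integral_cong) simp
  also have "integral {0..R} (\<lambda>s. v s * ?cos s) = a n - b n"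
  proof -
    have "integral {0..R} (\<lambda>s. v s * ?cos s) + b n = a n"
      unfolding a_def b_def using R v
      by (intro Henstock_Kurzweil_Integration.integral_combine integrable_continuous_real continuous_intros) auto
    then show ?thesis by simp
  qed
  finally have Tv: "integral {0..1} (\<lambda>r. T v r * ?cos r) = ?l * (a n - b n)" .
  have "a n = integral {0..1} (\<lambda>r. c * (G r 0 * ?cos r) + T v r * ?cos r)"
    unfolding a_def by (intro integral_cong) (simp add: eq algebra_simps)
  also have "\<dots> = integral {0..1} (\<lambda>r. c * (G r 0 * ?cos r)) + integral {0..1} (\<lambda>r. T v r * ?cos r)"
    by (intro integral_add integrable_continuous_real v
        continuous_intros continuous_on_T continuous_on_subset[OF v] subset_R continuous_on_G_left) auto
  also have "\<dots> = c * ?l + ?l * (a n - b n)"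
    using G_cos[of 0] by (simp add: Tv)
  finally show ?thesis by (simp add: algebra_simps)
qed

end

section \<open>Fixed points of the integral equation and fixed densities\<close>

context killed_heat
begin

lemma T_cong: "(\<And>s. s \<in> {0..R} \<Longrightarrow> f s = g s) \<Longrightarrow> T f r = T g r"
  unfolding T_def by (intro integral_cong) simp

lemma neum_conv_eq_T:
  assumes "\<And>s. s \<in> {R<..1} \<Longrightarrow> \<rho> s = 0"
  shows "neum_conv t c \<rho> r = c * G r 0 + T \<rho> r"
proof -
  have "integral {0..1} (\<lambda>s. G r s * \<rho> s) = integral {0..1} (\<lambda>s. if s \<in> {0..R} then G r s * \<rho> s else 0)"
    using assms by (intro integral_cong) auto
  also have "\<dots> = T \<rho> r"
    using subset_R(1)
    by (simp only: T_def Henstock_Kurzweil_Integration.integral_restrict_Int Int_absorb2)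
  finally show ?thesis by (simp add: neum_conv_def)
qed

context
  fixes c :: real and v :: "real \<Rightarrow> real"
  assumes c: "c > 0"
    and v: "continuous_on {0..1} v"
    and eq: "\<And>r. r \<in> {0..1} \<Longrightarrow> v r = c * G r 0 + T v r"
begin

text \<open>Nonnegativity is the comparison principle with a nonnegative source; strictness comes
  from the source c G(r,0) itself.\<close>

lemma fixed_point_pos:
  assumes r: "r \<in> {0..1}"
  shows "0 < v r"
proof -
  have nonneg: "0 \<le> v s" if "s \<in> {0..1}" for s
  proof (rule comparison[OF v _ that])
    fix s :: real assume s: "s \<in> {0..1}"
    then have "0 \<le> c * G s 0" using c G_pos[of s 0] by simp
    then show "T v s \<le> v s" unfolding eq[OF s] by simp
  qed
  have "0 \<le> T v r"
    unfolding T_def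
  proof (rule integral_nonneg[OF integrable_G[OF r v]])
    fix s assume "s \<in> {0..R}"
    then show "0 \<le> G r s * v s" using nonneg[of s] G_pos[of r s] r R by simp
  qed
  moreover have "0 < c * G r 0" using c G_pos[OF r, of 0] by simp
  ultimately show ?thesis unfolding eq[OF r] by linarith
qed

text \<open>For n = 0 the eigenvalue is 1 and a 0 cancels from the coefficient equation: in a
  stationary profile the mass removed equals the mass injected.\<close>

lemma killed_mass: "integral {R..1} v = c"
  using cos_coefficient_equation[OF v eq, of 0] by simp

text \<open>\<open>cut_point\<close> is a definite description, so uniqueness is needed too: v is
  bounded below by a positive constant, hence its tail integral is strictly decreasing in the left
  endpoint.\<close>

lemma cut_point_eq:
  assumes V: "\<And>r. r \<in> {0..1} \<Longrightarrow> V r = v r" and c_eq: "c = j * \<delta>"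
  shows "cut_point j \<delta> V = R"
proof -
  obtain r0 where r0: "r0 \<in> {0..1}" and min: "\<And>r. r \<in> {0..1} \<Longrightarrow> v r0 \<le> v r"
    using continuous_attains_inf[OF _ _ v] by auto
  have less: "integral {y..1} v < integral {x..1} v" if "0 \<le> x" "x < y" "y \<le> 1" for x y
  proof -
    have int: "v integrable_on {a..b}" if "0 \<le> a" "b \<le> 1" for a b
      using that by (intro integrable_continuous_real continuous_on_subset[OF v]) auto
    have "integral {x..y} (\<lambda>_. v r0) \<le> integral {x..y} v"
      using that by (intro integral_le int min) auto
    moreover have "0 < (y - x) * v r0" using that fixed_point_pos[OF r0] by simp
    moreover have "integral {x..y} v + integral {y..1} v = integral {x..1} v"
      using that by (intro Henstock_Kurzweil_Integration.integral_combine int) auto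
    ultimately show ?thesis using that by simp
  qed
  have V_int: "integral {x..1} V = integral {x..1} v" if "x \<in> {0..1}" for x
    using that V by (intro integral_cong) auto
  show ?thesis unfolding cut_point_def
  proof (rule the_equality)
    show "R \<in> {0..1} \<and> integral {R..1} V = j * \<delta>"
      using R V_int[of R] killed_mass c_eq by auto
    fix x assume x: "x \<in> {0..1} \<and> integral {x..1} V = j * \<delta>"
    then have "integral {x..1} v = integral {R..1} v" using V_int[of x] killed_mass c_eq by auto
    then show "x = R" using less[of x R] less[of R x] x R by (cases x R rule: linorder_cases) auto
  qed
qed

text \<open>T sees only values on [0,R], so truncating v at R leaves \<open>T v\<close> unchanged,
  and the heat step applied to the truncation returns v.\<close>

lemma fixed_density_truncation:
  assumes "c = j * t" "R = 1 - A * t"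
  shows "fixed_density j A t (\<lambda>r. if r \<le> R then v r else 0)"
proof -
  define \<rho> where "\<rho> r = (if r \<le> R then v r else 0)" for r
  have conv: "neum_conv t (j * t) \<rho> r = v r" if "r \<in> {0..1}" for r
  proof -
    have "neum_conv t (j * t) \<rho> r = c * G r 0 + T \<rho> r"
      using assms by (subst neum_conv_eq_T) (auto simp: \<rho>_def)
    also have "T \<rho> r = T v r" by (rule T_cong) (simp add: \<rho>_def)
    finally show ?thesis using eq[OF that] by simp
  qed
  have cut: "cut_point j t (neum_conv t (j * t) \<rho>) = R"
    using conv assms by (intro cut_point_eq)
  have "continuous_on {0..R} \<rho>"
    using continuous_on_subset[OF v subset_R(1)] by (rule continuous_on_eq) (simp add: \<rho>_def)
  then have "fixed_density j A t \<rho>"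
    using cut conv assms(2) less_imp_le[OF fixed_point_pos]
    unfolding fixed_density_def by (auto simp: \<rho>_def)
  then show ?thesis by (simp add: \<rho>_def[abs_def])
qed

text \<open>Uniqueness is applied to the heat-evolved profile V, not to \<sigma>: V is continuous on
  [0,1], agrees with \<sigma> on [0,R], and therefore solves the same equation as v.\<close>

lemma fixed_density_unique:
  assumes "c = j * t" "R = 1 - A * t" and \<sigma>: "fixed_density j A t \<sigma>" and r: "r \<in> {0..1}"
  shows "\<sigma> r = (if r \<le> R then v r else 0)"
proof -
  define V where "V = neum_conv t (j * t) \<sigma>"
  have \<sigma>_cont: "continuous_on {0..R} \<sigma>" and \<sigma>_0: "\<And>r. r \<in> {R<..1} \<Longrightarrow> \<sigma> r = 0"
    and \<sigma>_V: "\<And>r. r \<in> {0..1} \<Longrightarrow> \<sigma> r = (if r \<le> R then V r else 0)"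
    using \<sigma> assms(2) by (simp_all add: fixed_density_def V_def)
  have V_T: "V r = c * G r 0 + T \<sigma> r" for r
    using neum_conv_eq_T[OF \<sigma>_0] assms(1) by (simp add: V_def)
  have "continuous_on {0..1} (\<lambda>r. c * G r 0 + T \<sigma> r)"
    by (intro continuous_intros continuous_on_T \<sigma>_cont continuous_on_G_left) simp
  then have V_cont: "continuous_on {0..1} V" by (simp add: V_T[abs_def])
  have "T \<sigma> r = T V r" for r
    using R by (intro T_cong) (simp add: \<sigma>_V)
  then have "V r = v r"
    using V_T by (intro fixed_point_unique[OF V_cont v _ eq r]) auto
  then show ?thesis using \<sigma>_V[OF r] by simp
qed

end

end

section \<open>Convergence as the time step tends to zero\<close>

lemma abs_cos_diff_le: "\<bar>cos x - cos y\<bar> \<le> \<bar>x - y :: real\<bar>"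
proof -
  have "\<bar>cos x - cos y\<bar> = 2 * \<bar>sin ((x + y) / 2)\<bar> * \<bar>sin ((y - x) / 2)\<bar>"
    by (simp add: cos_diff_cos abs_mult)
  also have "\<dots> \<le> 2 * 1 * \<bar>(y - x) / 2\<bar>"
    by (intro mult_mono abs_sin_x_le_abs_x) auto
  finally show ?thesis by (simp add: abs_minus_commute)
qed

text \<open>Used with y = t x for an eigenvalue x. After multiplication by t, the difference between
  1/x and t / (exp (t x) - 1) is then at most t.\<close>

lemma inverse_minus_inverse_exp_minus_1:
  fixes y :: real
  assumes "y > 0"
  shows "1 / (exp y - 1) \<le> 1 / y" and "1 / y - 1 / (exp y - 1) \<le> 1"
proof -
  have y: "y \<le> exp y - 1" using exp_ge_add_one_self[of y] by linarith
  then show "1 / (exp y - 1) \<le> 1 / y" using assms by (intro divide_left_mono) auto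
  have "1 - y \<le> exp (- y)" using exp_ge_add_one_self[of "-y"] by simp
  then have "(1 - y) * exp y \<le> exp (- y) * exp y" by (intro mult_right_mono) auto
  also have "\<dots> = 1" by (simp flip: exp_add)
  finally show "1 / y - 1 / (exp y - 1) \<le> 1"
    using assms y by (simp add: field_simps)
qed

text \<open>The function j - 2 j r is the limit slope 2 j (1 - r) minus its mean j, and the
  denominator is the Neumann eigenvalue of minus half the second derivative.\<close>

lemma triangle_wave_cos_integral:
  assumes "n > 0"
  shows "integral {0..1} (\<lambda>r. (j - 2 * j * r) * cos (pi * real n * r))
    = j * (1 - (-1) ^ n) / ((pi * real n)\<^sup>2 / 2)"
proof -
  define w where "w = pi * real n"
  let ?F = "\<lambda>r. (j - 2 * j * r) * sin (w * r) / w - 2 * j * cos (w * r) / w\<^sup>2"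
  have w: "w \<noteq> 0" using assms by (simp add: w_def)
  have "((\<lambda>r. (j - 2 * j * r) * cos (w * r)) has_integral ?F 1 - ?F 0) {0..1}"
  proof (rule fundamental_theorem_of_calculus)
    fix r :: real
    have "(?F has_real_derivative (j - 2 * j * r) * cos (w * r)) (at r within {0..1})"
      using w by (auto intro!: derivative_eq_intros simp: field_simps power2_eq_square)
    then show "(?F has_vector_derivative (j - 2 * j * r) * cos (w * r)) (at r within {0..1})"
      by (simp add: has_real_derivative_iff_has_vector_derivative)
  qed simp
  moreover have "cos w = (-1) ^ n" "sin w = 0" by (simp_all add: w_def mult.commute)
  ultimately have "integral {0..1} (\<lambda>r. (j - 2 * j * r) * cos (w * r)) = j * (1 - (-1) ^ n) / (w\<^sup>2 / 2)"
    using w by (simp add: integral_unique field_simps)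
  then show ?thesis by (simp add: w_def)
qed

text \<open>The first term accounts for placing the removed mass at r = 1, the second for replacing
  1/(exp y - 1) by 1/y. In each minimum one entry vanishes with t and the other yields a summable
  bound free of t. At n = 0 division by zero gives the value 0 for t > 0.\<close>

definition coeff_error :: "real \<Rightarrow> real \<Rightarrow> nat \<Rightarrow> real \<Rightarrow> real" where
  "coeff_error j A n t = j / ((pi * real n)\<^sup>2 / 2) * min 2 (pi * real n * (A * t))
     + 2 * j * min t (1 / ((pi * real n)\<^sup>2 / 2))"

lemma coeff_error_bounds:
  assumes "j > 0" "A > 0" "t > 0"
  shows "0 \<le> coeff_error j A n t" "coeff_error j A n t \<le> 4 * j / ((pi * real n)\<^sup>2 / 2)"
proof -
  let ?x = "(pi * real n)\<^sup>2 / 2"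
  show "0 \<le> coeff_error j A n t"
    using assms unfolding coeff_error_def by (intro add_nonneg_nonneg mult_nonneg_nonneg) auto
  have "coeff_error j A n t \<le> j / ?x * 2 + 2 * j * (1 / ?x)"
    unfolding coeff_error_def using assms by (intro add_mono mult_left_mono) auto
  also have "\<dots> = 4 * j / ?x" by simp
  finally show "coeff_error j A n t \<le> 4 * j / ?x" .
qed

lemma summable_inverse_eigenvalues: "summable (\<lambda>n. C / ((pi * real n)\<^sup>2 / 2))"
proof -
  have "summable (\<lambda>n. 2 * C / pi\<^sup>2 * inverse (real n ^ 2))"
    by (intro summable_mult inverse_power_summable) simp
  then show ?thesis by (simp add: field_simps power_mult_distrib)
qed

lemma coeff_error_summable:
  assumes "j > 0" "A > 0" "t > 0"
  shows "summable (\<lambda>n. coeff_error j A n t)"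
  by (rule summable_comparison_test_ev[OF _ summable_inverse_eigenvalues[of "4 * j"]])
     (use coeff_error_bounds[OF assms] in auto)

text \<open>Tannery's theorem: each term tends to 0 and all are dominated by the summable 4j/x,
  where x is the n-th eigenvalue.\<close>

lemma coeff_error_tendsto_0:
  assumes "j > 0" "A > 0"
  shows "((\<lambda>t. \<Sum>n. coeff_error j A n t) \<longlongrightarrow> 0) (at_right 0)"
proof -
  have "((\<lambda>t. \<Sum>n. coeff_error j A n t) \<longlongrightarrow> (\<Sum>n. 0)) (at_right 0)"
  proof (rule tannerys_theorem[THEN conjunct2, THEN conjunct2])
    fix n
    let ?x = "(pi * real n)\<^sup>2 / 2"
    have "((\<lambda>t. coeff_error j A n t) \<longlongrightarrow> j / ?x * min 2 (pi * real n * (A * 0)) + 2 * j * min 0 (1 / ?x)) (at_right 0)"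
      unfolding coeff_error_def by (intro tendsto_intros)
    moreover have "min 0 (1 / ?x) = 0" by (simp add: min_def)
    ultimately show "((\<lambda>t. coeff_error j A n t) \<longlongrightarrow> 0) (at_right 0)" by (simp del: min_def)
  next
    have "\<forall>\<^sub>F x :: nat \<times> real in at_top \<times>\<^sub>F at_right 0. True \<and> 0 < snd x"
      using eventually_prodI[of "\<lambda>_. True" at_top "\<lambda>t. (0::real) < t" "at_right 0"]
      by (simp add: eventually_at_right_less)
    then show "\<forall>\<^sub>F (n, t) in at_top \<times>\<^sub>F at_right 0. norm (coeff_error j A n t) \<le> 4 * j / ((pi * real n)\<^sup>2 / 2)"
      by (rule eventually_mono) (use coeff_error_bounds[OF assms] in \<open>auto simp: case_prod_unfold\<close>)
  qed (use summable_inverse_eigenvalues[of "4 * j"] in auto)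
  then show ?thesis by simp
qed

text \<open>The factor 4 arises because the uniform bound \<epsilon> on \<open>d\<close>, twice the
  sum of the coefficient errors, enters once for the shape of v and once for its mean. The term 2 j
  A t is the variation of 2 j (1 - r) over [R,1].\<close>

lemma (in killed_heat) fixed_point_close_to_limit:
  assumes j: "j > 0" and A: "A > 0" and R_eq: "R = 1 - A * t"
    and v: "continuous_on {0..1} v"
    and eq: "\<And>r. r \<in> {0..1} \<Longrightarrow> v r = j * t * G r 0 + T v r"
    and r: "r \<in> {0..1}"
  shows "\<bar>v r - (2 * j * (1 - r) + j / A)\<bar> \<le> 4 * (\<Sum>n. coeff_error j A n t) + 2 * j * (A * t)"
proof -
  define a where "a n = integral {0..1} (\<lambda>r. v r * cos (pi * real n * r))" for n
  define b where "b n = integral {R..1} (\<lambda>r. v r * cos (pi * real n * r))" for n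
  define d where "d r = v r - a 0 - (j - 2 * j * r)" for r
  define \<epsilon> where "\<epsilon> = 2 * (\<Sum>n. coeff_error j A n t)"
  have jt: "j * t > 0" using j t by simp
  have v_int: "v integrable_on {0..1}" "v integrable_on {R..1}"
    using v continuous_on_subset[OF v subset_R(2)] by (auto intro: integrable_continuous_real)
  have d_cont: "continuous_on {0..1} d"
    unfolding d_def by (intro continuous_intros v)
  have mass: "integral {R..1} v = j * t"
    by (rule killed_mass[OF jt v eq])
  \<comment> \<open>The removed density is positive with mass j t, and on [R,1] the cosine differs
    from its value (-1)^n at r = 1 by at most 2 and at most frequency times length.\<close>
  have b_bound: "\<bar>b n - (-1) ^ n * (j * t)\<bar> \<le> j * t * min 2 (pi * real n * (A * t))" for n
  proof -
    let ?m = "min 2 (pi * real n * (A * t))"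
    have "b n - (-1) ^ n * (j * t) = integral {R..1} (\<lambda>r. v r * cos (pi * real n * r)) - integral {R..1} (\<lambda>r. v r * (-1) ^ n)"
      using mass by (simp add: b_def)
    also have "\<dots> = integral {R..1} (\<lambda>r. v r * cos (pi * real n * r) - v r * (-1) ^ n)"
      by (intro integral_diff[symmetric] integrable_continuous_real continuous_intros
          continuous_on_subset[OF v] subset_R)
    finally have "\<bar>b n - (-1) ^ n * (j * t)\<bar> = norm (integral {R..1} (\<lambda>r. v r * cos (pi * real n * r) - v r * (-1) ^ n))"
      by simp
    also have "\<dots> \<le> integral {R..1} (\<lambda>r. v r * ?m)"
    proof (rule integral_norm_bound_integral)
      fix r assume r: "r \<in> {R..1}"
      have "\<bar>cos (pi * real n * r) - cos (pi * real n)\<bar> \<le> pi * real n * \<bar>r - 1\<bar>"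
      proof -
        have "pi * real n * r - pi * real n = pi * real n * (r - 1)" by (simp add: algebra_simps)
        then show ?thesis
          using abs_cos_diff_le[of "pi * real n * r" "pi * real n"] by (simp only: abs_mult) simp
      qed
      also have "\<dots> \<le> pi * real n * (A * t)"
        using r R_eq by (intro mult_left_mono) auto
      finally have "\<bar>cos (pi * real n * r) - cos (pi * real n)\<bar> \<le> pi * real n * (A * t)" .
      moreover have "\<bar>cos (pi * real n * r) - cos (pi * real n)\<bar> \<le> 2"
        using abs_cos_le_one[of "pi * real n * r"] abs_cos_le_one[of "pi * real n"] by linarith
      moreover have "cos (pi * real n) = (-1) ^ n" by (simp add: mult.commute)
      ultimately have "\<bar>cos (pi * real n * r) - (-1) ^ n\<bar> \<le> ?m" by simp
      moreover have "0 < v r" using fixed_point_pos[OF jt v eq] r R by auto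
      ultimately have "\<bar>v r\<bar> * \<bar>cos (pi * real n * r) - (-1) ^ n\<bar> \<le> v r * ?m"
        by (intro mult_mono) auto
      then show "norm (v r * cos (pi * real n * r) - v r * (-1) ^ n) \<le> v r * ?m"
        by (simp flip: right_diff_distrib add: abs_mult)
    qed (intro integrable_continuous_real continuous_intros continuous_on_subset[OF v] subset_R)+
    also have "\<dots> = j * t * ?m" using mass by simp
    finally show ?thesis .
  qed
  have d_coeff: "\<bar>integral {0..1} (\<lambda>r. d r * cos (pi * real n * r))\<bar> \<le> coeff_error j A n t" for n
  proof (cases "n = 0")
    case True
    have "integral {0..1} (\<lambda>r. j - 2 * j * r) = 0"
    proof -
      have "((\<lambda>r. j - 2 * j * r) has_integral (j * 1 - j * 1\<^sup>2) - (j * 0 - j * 0\<^sup>2)) {0..1}"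
        by (rule fundamental_theorem_of_calculus)
           (auto intro!: derivative_eq_intros simp flip: has_real_derivative_iff_has_vector_derivative)
      then show ?thesis by (simp add: integral_unique)
    qed
    moreover have "integral {0..1} d = integral {0..1} v - integral {0..1} (\<lambda>_::real. a 0) - integral {0..1} (\<lambda>r. j - 2 * j * r)"
      unfolding d_def[abs_def]
      by (subst integral_diff, (intro integrable_continuous_real continuous_intros v)+)+ simp
    ultimately have "integral {0..1} d = 0" by (simp add: a_def)
    then show ?thesis using True coeff_error_bounds[OF j A t, of n] by simp
  next
    case False
    define x where "x = (pi * real n)\<^sup>2 / 2"
    have x: "x > 0" using False by (simp add: x_def)
    \<comment> \<open>The factor that solves the coefficient equation: a n = (j t - b n)
      \<kappa>.\<close>
    define \<kappa> where "\<kappa> = 1 / (exp (t * x) - 1)"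
    have tx: "t * x > 0" using t x by simp
    have \<kappa>: "0 \<le> \<kappa>" "\<kappa> \<le> 1 / (t * x)" "1 / (t * x) - \<kappa> \<le> 1"
      using inverse_minus_inverse_exp_minus_1[OF tx] tx by (auto simp: \<kappa>_def)
    have "a n = exp (- (t * x)) * (j * t + a n - b n)"
      using cos_coefficient_equation[OF v eq, of n] by (simp add: a_def b_def x_def)
    then have "a n * exp (t * x) = j * t + a n - b n"
      by (metis exp_minus_inverse mult.assoc mult.commute mult_1)
    then have "a n * (exp (t * x) - 1) = j * t - b n" by (simp add: right_diff_distrib)
    moreover have "exp (t * x) - 1 \<noteq> 0" using t x by simp
    ultimately have "a n = (j * t - b n) * \<kappa>"
      unfolding \<kappa>_def by (simp add: eq_divide_eq)
    moreover have "integral {0..1} (\<lambda>r. d r * cos (pi * real n * r)) = a n - j * (1 - (-1) ^ n) / x"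
    proof -
      have "integral {0..1} (\<lambda>r. d r * cos (pi * real n * r))
          = integral {0..1} (\<lambda>r. v r * cos (pi * real n * r) - a 0 * cos (pi * real n * r)
              - (j - 2 * j * r) * cos (pi * real n * r))"
        by (simp add: d_def left_diff_distrib)
      also have "\<dots> = a n - integral {0..1} (\<lambda>r. a 0 * cos (pi * real n * r))
              - integral {0..1} (\<lambda>r. (j - 2 * j * r) * cos (pi * real n * r))"
        unfolding a_def
        by (subst integral_diff, (intro integrable_continuous_real continuous_intros v)+)+ simp
      also have "integral {0..1} (\<lambda>r. a 0 * cos (pi * real n * r)) = 0"
        using integral_cos_pi_int[of "int n"] False by simp
      finally show ?thesis using triangle_wave_cos_integral[of n j] False by (simp add: x_def)
    qed
    \<comment> \<open>Adding and subtracting (-1)^n j t separates the two sources of error recorded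
      in \<open>coeff_error\<close>.\<close>
    ultimately have "integral {0..1} (\<lambda>r. d r * cos (pi * real n * r))
        = ((-1) ^ n * (j * t) - b n) * \<kappa> - j * (1 - (-1) ^ n) * (1 / x - t * \<kappa>)"
      by (simp add: algebra_simps diff_divide_distrib)
    also have "\<bar>\<dots>\<bar> \<le> \<bar>((-1) ^ n * (j * t) - b n) * \<kappa>\<bar> + \<bar>j * (1 - (-1) ^ n) * (1 / x - t * \<kappa>)\<bar>"
      by (rule abs_triangle_ineq4)
    also have "\<dots> \<le> j / x * min 2 (pi * real n * (A * t)) + 2 * j * min t (1 / x)"
    proof (rule add_mono)
      have "\<bar>((-1) ^ n * (j * t) - b n) * \<kappa>\<bar> = \<bar>b n - (-1) ^ n * (j * t)\<bar> * \<kappa>"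
        using \<kappa>(1) by (simp add: abs_mult abs_minus_commute)
      also have "\<dots> \<le> (j * t * min 2 (pi * real n * (A * t))) * (1 / (t * x))"
        by (rule mult_mono[OF b_bound \<kappa>(2) order_trans[OF abs_ge_zero b_bound] \<kappa>(1)])
      also have "\<dots> = j / x * min 2 (pi * real n * (A * t))" using t by simp
      finally show "\<bar>((-1) ^ n * (j * t) - b n) * \<kappa>\<bar> \<le> j / x * min 2 (pi * real n * (A * t))" .
      have eq: "1 / x - t * \<kappa> = t * (1 / (t * x) - \<kappa>)" using t by (simp add: algebra_simps)
      have "0 \<le> 1 / x - t * \<kappa>" "1 / x - t * \<kappa> \<le> t"
        unfolding eq using \<kappa> t by simp_all
      moreover have "1 / x - t * \<kappa> \<le> 1 / x" using \<kappa> t by simp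
      moreover have "\<bar>1 - (-1) ^ n\<bar> \<le> (2 :: real)" by (cases "even n") auto
      ultimately have "j * \<bar>1 - (-1) ^ n\<bar> * \<bar>1 / x - t * \<kappa>\<bar> \<le> (j * 2) * min t (1 / x)"
        using j by (intro mult_mono) auto
      then show "\<bar>j * (1 - (-1) ^ n) * (1 / x - t * \<kappa>)\<bar> \<le> 2 * j * min t (1 / x)"
        using j by (simp add: abs_mult mult_ac)
    qed
    finally show ?thesis by (simp add: coeff_error_def x_def)
  qed
  have d_bound: "\<bar>d r\<bar> \<le> \<epsilon>" if "r \<in> {0..1}" for r
  proof -
    have sum: "summable (\<lambda>n. \<bar>integral {0..1} (\<lambda>r. d r * cos (pi * real n * r))\<bar>)"
      by (rule summable_comparison_test_ev[OF _ coeff_error_summable[OF j A t]])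
         (use d_coeff in auto)
    have "\<bar>d r\<bar> \<le> 2 * (\<Sum>n. \<bar>integral {0..1} (\<lambda>r. d r * cos (pi * real n * r))\<bar>)"
      by (rule abs_le_suminf_cos_coefficients[OF d_cont sum that])
    also have "\<dots> \<le> \<epsilon>"
      unfolding \<epsilon>_def by (intro mult_left_mono suminf_le d_coeff sum coeff_error_summable j A t) simp
    finally show ?thesis .
  qed
  have At: "A * t > 0" using A t by simp
  \<comment> \<open>The average of v over [R,1] is j t / (A t) = j/A, while a 0 - j is the value at
    r = 1 of the approximation a 0 + j - 2 j r. Comparing them determines the mean a 0.\<close>
  have "\<bar>(j / A - (a 0 - j)) * (A * t)\<bar> = norm (integral {R..1} (\<lambda>r. v r - (a 0 - j)))"
  proof -
    have "integral {R..1} (\<lambda>r. v r - (a 0 - j)) = j * t - (a 0 - j) * (A * t)"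
      using v_int(2) mass R_eq At by (subst integral_diff) (auto simp: mult.commute)
    also have "\<dots> = (j / A - (a 0 - j)) * (A * t)" using A by (simp add: field_simps)
    finally show ?thesis by simp
  qed
  also have "\<dots> \<le> integral {R..1} (\<lambda>r. \<epsilon> + 2 * j * (A * t))"
  proof (rule integral_norm_bound_integral)
    fix r assume r: "r \<in> {R..1}"
    have "v r - (a 0 - j) = d r + 2 * j * (1 - r)" by (simp add: d_def algebra_simps)
    moreover have "\<bar>d r\<bar> \<le> \<epsilon>" using d_bound r R by auto
    moreover have "0 \<le> 2 * j * (1 - r)" "2 * j * (1 - r) \<le> 2 * j * (A * t)"
      using r R_eq j by (auto intro!: mult_left_mono mult_nonneg_nonneg)
    ultimately show "norm (v r - (a 0 - j)) \<le> \<epsilon> + 2 * j * (A * t)" by simp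
  qed (use v_int(2) in \<open>auto intro!: integrable_diff\<close>)
  also have "\<dots> = (\<epsilon> + 2 * j * (A * t)) * (A * t)" using R_eq At by simp
  finally have "\<bar>j / A - (a 0 - j)\<bar> \<le> \<epsilon> + 2 * j * (A * t)"
    unfolding abs_mult[of _ "A * t"] abs_of_pos[OF At] by (rule mult_right_le_imp_le[OF _ At])
  moreover have "v r - (2 * j * (1 - r) + j / A) = d r - (j / A - (a 0 - j))"
    by (simp add: d_def algebra_simps)
  ultimately have "\<bar>v r - (2 * j * (1 - r) + j / A)\<bar> \<le> 2 * \<epsilon> + 2 * j * (A * t)"
    using d_bound[OF r] by linarith
  then show ?thesis by (simp add: \<epsilon>_def)
qed

theorem theorem3p5:
  fixes j A :: real
  assumes "j > 0" and "A > 0"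
  shows "\<exists>\<delta>0>0. \<exists>\<rho> :: real \<Rightarrow> real \<Rightarrow> real.
           (\<forall>\<delta>\<in>{0<..<\<delta>0}.
              fixed_density j A \<delta> (\<rho> \<delta>) \<and>
              (\<forall>\<sigma>. fixed_density j A \<delta> \<sigma> \<longrightarrow> (\<forall>r\<in>{0..1}. \<sigma> r = \<rho> \<delta> r))) \<and>
           (\<forall>r\<in>{0..<1}. ((\<lambda>\<delta>. \<rho> \<delta> r) \<longlongrightarrow> 2 * j * (1 - r) + j / A) (at_right 0))"
proof -
  \<comment> \<open>The threshold 1/A is what places 1 - A \<delta> strictly between 0 and
    1.\<close>
  have kh: "killed_heat \<delta> (1 - A * \<delta>)" if "\<delta> \<in> {0<..<1 / A}" for \<delta>
    using that assms by unfold_locales (auto simp: field_simps)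
  have "\<exists>v. continuous_on {0..1} v \<and>
      (\<forall>r\<in>{0..1}. v r = j * \<delta> * neum_green \<delta> r 0 + killed_heat.T \<delta> (1 - A * \<delta>) v r)"
    if \<delta>: "\<delta> \<in> {0<..<1 / A}" for \<delta>
  proof -
    interpret killed_heat \<delta> "1 - A * \<delta>" by (rule kh[OF \<delta>])
    have "continuous_on {0..1} (\<lambda>r. j * \<delta> * neum_green \<delta> r 0)"
      by (intro continuous_intros continuous_on_G_left) simp
    then show ?thesis by (rule fixed_point_exists) blast
  qed
  then obtain v where v: "\<And>\<delta>. \<delta> \<in> {0<..<1 / A} \<Longrightarrow> continuous_on {0..1} (v \<delta>)"
    and eq: "\<And>\<delta> r. \<delta> \<in> {0<..<1 / A} \<Longrightarrow> r \<in> {0..1} \<Longrightarrow>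
      v \<delta> r = j * \<delta> * neum_green \<delta> r 0 + killed_heat.T \<delta> (1 - A * \<delta>) (v \<delta>) r"
    by metis
  define \<rho> where "\<rho> \<delta> r = (if r \<le> 1 - A * \<delta> then v \<delta> r else 0)" for \<delta> r
  have "fixed_density j A \<delta> (\<rho> \<delta>)" if "\<delta> \<in> {0<..<1 / A}" for \<delta>
    using killed_heat.fixed_density_truncation[OF kh[OF that] _ v[OF that] eq[OF that], of j A]
      that assms by (simp add: \<rho>_def[abs_def])
  moreover have "\<sigma> r = \<rho> \<delta> r" if "\<delta> \<in> {0<..<1 / A}" "fixed_density j A \<delta> \<sigma>" "r \<in> {0..1}" for \<delta> \<sigma> r
    using killed_heat.fixed_density_unique[OF kh[OF that(1)] _ v[OF that(1)] eq[OF that(1)] _ _ that(2,3)]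
      that(1) assms by (simp add: \<rho>_def)
  moreover have "((\<lambda>\<delta>. \<rho> \<delta> r) \<longlongrightarrow> 2 * j * (1 - r) + j / A) (at_right 0)" if r: "r \<in> {0..<1}" for r
  proof (rule LIM_zero_cancel, rule Lim_null_comparison)
    \<comment> \<open>The second bound puts r to the left of the cut, where \<rho> agrees with v; it
      can be met because r < 1.\<close>
    have "\<forall>\<^sub>F \<delta> in at_right 0. \<delta> < 1 / A" "\<forall>\<^sub>F \<delta> in at_right 0. \<delta> < (1 - r) / A"
      using assms r by (auto intro!: order_tendstoD(2)[OF tendsto_ident_at])
    moreover have "\<forall>\<^sub>F \<delta> in at_right (0::real). 0 < \<delta>" by (rule eventually_at_right_less)
    ultimately show "\<forall>\<^sub>F \<delta> in at_right 0. norm (\<rho> \<delta> r - (2 * j * (1 - r) + j / A))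
        \<le> 4 * (\<Sum>n. coeff_error j A n \<delta>) + 2 * j * (A * \<delta>)"
    proof eventually_elim
      case (elim \<delta>)
      then have \<delta>: "\<delta> \<in> {0<..<1 / A}" and "r \<le> 1 - A * \<delta>"
        using assms by (auto simp: field_simps)
      then show ?case
        using killed_heat.fixed_point_close_to_limit[OF kh[OF \<delta>] assms refl v[OF \<delta>] eq[OF \<delta>], of r] r
        by (simp add: \<rho>_def)
    qed
    have "((\<lambda>\<delta>. 4 * (\<Sum>n. coeff_error j A n \<delta>) + 2 * j * (A * \<delta>)) \<longlongrightarrow> 4 * 0 + 2 * j * (A * 0)) (at_right 0)"
      by (intro tendsto_intros coeff_error_tendsto_0 assms)
    then show "((\<lambda>\<delta>. 4 * (\<Sum>n. coeff_error j A n \<delta>) + 2 * j * (A * \<delta>)) \<longlongrightarrow> 0) (at_right 0)" by simp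
  qed
  ultimately show ?thesis
    using assms by (intro exI[of _ "1 / A"] conjI[of "1 / A > 0"] exI[of _ \<rho>]) auto
qed

end
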